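(* Let $G$ be a graph without isolated vertices and with $n(G)$ vertices. Then $\gamma_{LLg}(G)\le n(G)+1$. Moreover, equality $\gamma_{LLg}(G)=n(G)+1$ holds if and only if every connected component of $G$ is isomorphic to $K_2$.
   Context: All graphs are finite, simple and have at least one vertex. For a vertex $v$ of a graph $G$, $N(v)$ is its open neighborhood and $N[v]=N(v)\cup\{v\}$ its closed neighborhood. In the LL-domination game on $G$ two players, Dominator and Staller, alternately select a vertex of $G$. In the $i$-th move, after the moves $v_1,\dots,v_{i-1}$, the choice of a vertex $v_i$ is legal if $N[v_i]\setminus\bigcup_{j=1}^{i-1}N(v_j)\neq\emptyset$ (a vertex may be selected repeatedly as long as this holds). The game ends when no legal move is available; its length is the total number of moves played (an unending play has infinite length). Dominator wants to minimize the length, Staller wants to maximize it. The number $\gamma_{LLg}(G)$ is the length of the game under optimal play by both players when Dominator moves first. *)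

theory Defs
  imports "HOL-Library.Extended_Nat" "Graph_Theory.Graph_Theory"
begin

text \<open>
  A finite simple graph is a digraph satisfying the locale predicate \<^const>\<open>graph\<close>: finite,
  loop-free, without parallel arcs, and symmetric. The locale admits the null graph.
\<close>

definition open_nbhd :: "('a, 'b) pre_digraph \<Rightarrow> 'a \<Rightarrow> 'a set" where
  "open_nbhd G v = {u. v \<rightarrow>\<^bsub>G\<^esub> u}"

definition closed_nbhd :: "('a, 'b) pre_digraph \<Rightarrow> 'a \<Rightarrow> 'a set" where
  "closed_nbhd G v = open_nbhd G v \<union> {v}"

definition isolated :: "('a, 'b) pre_digraph \<Rightarrow> 'a \<Rightarrow> bool" where
  "isolated G v \<longleftrightarrow> v \<in> verts G \<and> open_nbhd G v = {}"

text \<open>Connected components are the maximal connected subgraphs.\<close>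

definition component :: "('a, 'b) pre_digraph \<Rightarrow> ('a, 'b) pre_digraph \<Rightarrow> bool" where
  "component G C \<longleftrightarrow> pre_digraph.max_subgraph G Digraph_Component.connected C"

definition complete_graph :: "nat \<Rightarrow> nat pair_pre_digraph" where
  "complete_graph n = \<lparr> pverts = {..<n}, parcs = {(i, j). i < n \<and> j < n \<and> i \<noteq> j} \<rparr>"

text \<open>
  A history \<open>h\<close> is the list of the vertices selected so far, oldest first. Dominator is to move
  exactly when its length is even.
\<close>

definition LL_legal :: "('a, 'b) pre_digraph \<Rightarrow> 'a list \<Rightarrow> 'a \<Rightarrow> bool" where
  "LL_legal G h v \<longleftrightarrow> v \<in> verts G \<and> closed_nbhd G v - (\<Union>u\<in>set h. open_nbhd G u) \<noteq> {}"

definition LL_over :: "('a, 'b) pre_digraph \<Rightarrow> 'a list \<Rightarrow> bool" where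
  "LL_over G h \<longleftrightarrow> \<not> (\<exists>v. LL_legal G h v)"

text \<open>
  A strategy is a function of the whole history, so it is total on lists; its values on finished
  games, on the opponent's turns and on histories that do not occur have no influence on a play.
  Hence one set of strategies serves both players.
\<close>

definition LL_strategies :: "('a, 'b) pre_digraph \<Rightarrow> ('a list \<Rightarrow> 'a) set" where
  "LL_strategies G = {\<sigma>. \<forall>h. \<not> LL_over G h \<longrightarrow> LL_legal G h (\<sigma> h)}"

text \<open>
  \<open>LL_play G \<sigma> \<tau> n\<close> is the history after \<open>n\<close> rounds when Dominator, who starts, follows \<open>\<sigma>\<close>
  and Staller follows \<open>\<tau>\<close>; it stays constant once the game is over. The length of the play is
  therefore the supremum of the lengths of these histories, which is \<open>\<infinity>\<close> for an unending play.
\<close>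

primrec LL_play ::
  "('a, 'b) pre_digraph \<Rightarrow> ('a list \<Rightarrow> 'a) \<Rightarrow> ('a list \<Rightarrow> 'a) \<Rightarrow> nat \<Rightarrow> 'a list" where
  "LL_play G \<sigma> \<tau> 0 = []"
| "LL_play G \<sigma> \<tau> (Suc n) =
     (let h = LL_play G \<sigma> \<tau> n
      in if LL_over G h then h else h @ [if even (length h) then \<sigma> h else \<tau> h])"

definition LL_length ::
  "('a, 'b) pre_digraph \<Rightarrow> ('a list \<Rightarrow> 'a) \<Rightarrow> ('a list \<Rightarrow> 'a) \<Rightarrow> enat" where
  "LL_length G \<sigma> \<tau> = (SUP n. enat (length (LL_play G \<sigma> \<tau> n)))"

definition gamma_LLg :: "('a, 'b) pre_digraph \<Rightarrow> enat" where
  "gamma_LLg G = (INF \<sigma>\<in>LL_strategies G. SUP \<tau>\<in>LL_strategies G. LL_length G \<sigma> \<tau>)"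

end

(* Call a selected vertex dangling while it is uncovered, and an unselected vertex alive while its
   closed neighborhood is not covered. Only a dangling vertex can be selected again, so the number
   of remaining moves is the number of alive vertices that will be selected plus the number of
   repetitions. Dominator keeps at most one dangling vertex, and covers a vertex as soon as Staller
   repeats it; if nothing is dangling, he plays a covered neighbor of an uncovered vertex, and only
   when there is none he opens a new part of the graph with a vertex that becomes dangling. Opening
   can cost one repetition, but it is available only after everything touched so far has been
   covered, and the move which completed that left another vertex unselected. Hence at most n + 1
   moves.

   If some degree is at least 2, Dominator saves one more move. If a vertex d of degree at least 2
   has a leaf l, he starts with d: after a repetition of d he covers it by a neighbor other than l,
   and then l is never selected. Otherwise the vertices of degree at least 2 form a union of
   components without leaves, and the move that completes their covering leaves an additional vertex
   that cannot be selected any more.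

   If all degrees are 1, each move covers at most one new vertex, and Staller wastes her first move
   by repeating Dominator's. *)

theory Submission
  imports Defs
begin

section \<open>Forcing the end of the game\<close>

text \<open>Backward induction on a move budget: Dominator can end the game within \<open>k\<close>
  further moves. Accepting finished games at every \<open>k\<close> makes this an upper bound, hence
  monotone in \<open>k\<close>.\<close>

primrec forces :: "('a, 'b) pre_digraph \<Rightarrow> nat \<Rightarrow> 'a list \<Rightarrow> bool" where
  "forces G 0 h \<longleftrightarrow> LL_over G h"
| "forces G (Suc k) h \<longleftrightarrow> LL_over G h \<or>
     (if even (length h) then \<exists>v. LL_legal G h v \<and> forces G k (h @ [v])
      else \<forall>v. LL_legal G h v \<longrightarrow> forces G k (h @ [v]))"

lemma forces_over: "LL_over G h \<Longrightarrow> forces G k h"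
  by (cases k) auto

lemma forces_mono: "forces G j h \<Longrightarrow> j \<le> k \<Longrightarrow> forces G k h"
proof (induction j arbitrary: h k)
  case 0
  then show ?case by (simp add: forces_over)
next
  case (Suc j)
  then obtain k' where "k = Suc k'" "j \<le> k'"
    by (cases k) auto
  with Suc show ?case by (auto split: if_splits)
qed

lemma forces_dominator:
  assumes "even (length h)" "LL_legal G h v" "forces G j (h @ [v])" "Suc j \<le> k"
  shows "forces G k h"
  by (rule forces_mono[OF _ assms(4)]) (use assms in auto)

lemma forces_staller:
  assumes "odd (length h)"
    and "\<And>v. LL_legal G h v \<Longrightarrow> \<exists>j. forces G j (h @ [v]) \<and> Suc j \<le> k"
  shows "forces G k h"
proof (cases "LL_over G h")
  case False
  then obtain v where "LL_legal G h v" by (auto simp: LL_over_def)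
  with assms(2) obtain i where k: "k = Suc i" by (cases k) auto
  have "forces G i (h @ [v])" if "LL_legal G h v" for v
    using assms(2)[OF that] k by (auto intro: forces_mono)
  with k assms(1) show ?thesis by simp
qed (rule forces_over)

text \<open>A strategy must be legal at every unfinished history, but a construction prescribes
  moves only where \<open>P\<close> holds. Elsewhere any legal move serves, and the choice is made
  history by history.\<close>

lemma strategy_ex:
  assumes "\<And>h. \<not> LL_over G h \<Longrightarrow> P h \<Longrightarrow> \<exists>v. LL_legal G h v \<and> Q h v"
  shows "\<exists>\<sigma>\<in>LL_strategies G. \<forall>h. \<not> LL_over G h \<longrightarrow> P h \<longrightarrow> Q h (\<sigma> h)"
proof -
  have "\<exists>v. \<not> LL_over G h \<longrightarrow> LL_legal G h v \<and> (P h \<longrightarrow> Q h v)" for h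
    using assms by (auto simp: LL_over_def)
  then obtain \<sigma> where "\<not> LL_over G h \<longrightarrow> LL_legal G h (\<sigma> h) \<and> (P h \<longrightarrow> Q h (\<sigma> h))" for h
    by metis
  then show ?thesis by (intro bexI[of _ \<sigma>]) (auto simp: LL_strategies_def)
qed

text \<open>Dominator always moves so that the game stays forced within \<open>k - length h\<close>
  moves. This is an invariant of every play against any Staller, so no history grows beyond
  \<open>k\<close>.\<close>

lemma gamma_LLg_le_if_forces:
  assumes "forces G k []"
  shows "gamma_LLg G \<le> enat k"
proof -
  have "\<exists>\<sigma>\<in>LL_strategies G. \<forall>h. \<not> LL_over G h \<longrightarrow>
      even (length h) \<and> length h < k \<and> forces G (k - length h) h \<longrightarrow>
      forces G (k - Suc (length h)) (h @ [\<sigma> h])"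
  proof (rule strategy_ex)
    fix h assume "\<not> LL_over G h"
      and *: "even (length h) \<and> length h < k \<and> forces G (k - length h) h"
    then have "forces G (Suc (k - Suc (length h))) h"
      by (simp add: Suc_diff_Suc)
    with \<open>\<not> LL_over G h\<close> *
    show "\<exists>v. LL_legal G h v \<and> forces G (k - Suc (length h)) (h @ [v])"
      by simp
  qed
  then obtain \<sigma> where \<sigma>: "\<sigma> \<in> LL_strategies G"
    and forces_\<sigma>: "\<And>h. \<not> LL_over G h \<Longrightarrow> even (length h) \<Longrightarrow> length h < k \<Longrightarrow>
      forces G (k - length h) h \<Longrightarrow> forces G (k - Suc (length h)) (h @ [\<sigma> h])"
    by blast
  have "LL_length G \<sigma> \<tau> \<le> enat k" if \<tau>: "\<tau> \<in> LL_strategies G" for \<tau>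
  proof -
    have "length (LL_play G \<sigma> \<tau> n) \<le> k \<and>
        forces G (k - length (LL_play G \<sigma> \<tau> n)) (LL_play G \<sigma> \<tau> n)" for n
    proof (induction n)
      case 0
      then show ?case using assms by simp
    next
      case (Suc n)
      define h where "h = LL_play G \<sigma> \<tau> n"
      have h: "length h \<le> k" "forces G (k - length h) h"
        using Suc unfolding h_def by auto
      show ?case
      proof (cases "LL_over G h")
        case True
        with h show ?thesis by (simp add: h_def[symmetric])
      next
        case False
        \<comment> \<open>At length \<open>k\<close> the invariant reads
          \<open>forces G 0 h\<close>, which says that the game is over.\<close>
        with h have less: "length h < k" by (cases "length h = k") auto
        have "forces G (k - Suc (length h)) (h @ [if even (length h) then \<sigma> h else \<tau> h])"
        proof (cases "even (length h)")
          case True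
          with forces_\<sigma>[OF False] h less show ?thesis by simp
        next
          case odd: False
          have "forces G (Suc (k - Suc (length h))) h"
            using h less by (simp add: Suc_diff_Suc)
          with odd False \<tau> show ?thesis by (auto simp: LL_strategies_def)
        qed
        with False less show ?thesis by (simp add: h_def[symmetric] Let_def)
      qed
    qed
    then show ?thesis by (auto simp: LL_length_def intro!: SUP_least)
  qed
  with \<sigma> show ?thesis unfolding gamma_LLg_def
    by (meson INF_lower2 SUP_least)
qed

section \<open>Uncovered, alive and dangling vertices\<close>

locale LL_graph = graph G for G :: "('a, 'b) pre_digraph" (structure) +
  assumes not_isolated: "\<not> isolated G v"
begin

abbreviation N :: "'a \<Rightarrow> 'a set" where
  "N \<equiv> open_nbhd G"

lemma N_sym: "u \<in> N v \<longleftrightarrow> v \<in> N u"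
  using graph_symmetric by (auto simp: open_nbhd_def)

lemma N_verts: "u \<in> N v \<Longrightarrow> u \<in> verts G" "u \<in> N v \<Longrightarrow> v \<in> verts G"
  by (auto simp: open_nbhd_def arcs_ends_conv)

lemma N_irrefl [simp]: "v \<notin> N v"
  using adj_not_same by (auto simp: open_nbhd_def)

lemma finite_N [simp]: "finite (N v)"
  by (rule finite_subset[OF _ finite_verts]) (auto dest: N_verts)

lemma N_nonempty: "v \<in> verts G \<Longrightarrow> N v \<noteq> {}"
  using not_isolated[of v] by (simp add: isolated_def)

definition uncovered :: "'a list \<Rightarrow> 'a set" where
  "uncovered h = verts G - (\<Union>u\<in>set h. N u)"

definition alive :: "'a list \<Rightarrow> 'a set" where
  "alive h = {x \<in> verts G - set h. closed_nbhd G x \<inter> uncovered h \<noteq> {}}"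

definition dangling :: "'a list \<Rightarrow> 'a set" where
  "dangling h = set h \<inter> uncovered h"

lemma uncovered_snoc: "uncovered (h @ [v]) = uncovered h - N v"
  by (auto simp: uncovered_def)

lemma uncovered_verts: "x \<in> uncovered h \<Longrightarrow> x \<in> verts G"
  by (simp add: uncovered_def)

lemma uncovered_N: "x \<in> uncovered h \<Longrightarrow> w \<in> N x \<Longrightarrow> w \<notin> set h"
  by (auto simp: uncovered_def N_sym)

lemma LL_legal_iff: "LL_legal G h v \<longleftrightarrow> v \<in> verts G \<and> closed_nbhd G v \<inter> uncovered h \<noteq> {}"
  using N_verts by (auto simp: LL_legal_def uncovered_def closed_nbhd_def)

lemma LL_over_iff: "LL_over G h \<longleftrightarrow> uncovered h = {}"
  by (auto simp: LL_over_def LL_legal_iff closed_nbhd_def dest: uncovered_verts)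

lemma finite_alive [simp]: "finite (alive h)"
  by (simp add: alive_def)

lemma alive_snoc: "alive (h @ [v]) \<subseteq> alive h - {v}"
  by (auto simp: alive_def uncovered_snoc)

lemma alive_if_legal: "LL_legal G h v \<Longrightarrow> v \<notin> set h \<Longrightarrow> v \<in> alive h"
  by (auto simp: alive_def LL_legal_iff)

lemma dangling_snoc: "dangling (h @ [v]) = (dangling h \<union> ({v} \<inter> uncovered h)) - N v"
  by (auto simp: dangling_def uncovered_snoc)

text \<open>Selecting \<open>v\<close> covers all its neighbors, so only \<open>v\<close> itself can
  make a second selection legal.\<close>

lemma dangling_if_repeated: "LL_legal G h v \<Longrightarrow> v \<in> set h \<Longrightarrow> v \<in> dangling h"
  by (auto simp: LL_legal_iff dangling_def uncovered_def closed_nbhd_def)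

text \<open>A selected neighbor would have covered \<open>x\<close>; an unselected one has
  \<open>x\<close> in its closed neighborhood.\<close>

lemma N_alive: "x \<in> uncovered h \<Longrightarrow> N x \<subseteq> alive h"
  using uncovered_N N_verts by (fastforce simp: alive_def closed_nbhd_def N_sym)

lemma uncovered_alive: "x \<in> uncovered h \<Longrightarrow> x \<notin> set h \<Longrightarrow> x \<in> alive h"
  by (auto simp: alive_def closed_nbhd_def dest: uncovered_verts)

lemma legal_N: "x \<in> uncovered h \<Longrightarrow> y \<in> N x \<Longrightarrow> LL_legal G h y"
  using N_sym N_verts by (auto simp: LL_legal_iff closed_nbhd_def)

text \<open>The counting device of all the bounds: exhibit a set \<open>B\<close> of alive vertices
  that are selected or become unplayable.\<close>

lemma card_alive_drop:
  assumes "alive h' \<subseteq> alive h - B" "B \<subseteq> alive h"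
  shows "card (alive h') + card B \<le> card (alive h)"
proof -
  have "card (alive h') \<le> card (alive h - B)" using assms by (intro card_mono) auto
  also have "\<dots> = card (alive h) - card B" using assms by (intro card_Diff_subset) (auto intro: finite_subset)
  finally show ?thesis using assms card_mono[of "alive h" B] by simp
qed

lemma alive_snoc2: "alive (h @ [v, y]) \<subseteq> alive h - {v, y}"
  using alive_snoc[of "h @ [v]" y] alive_snoc[of h v] by auto

lemma card_alive_snoc2:
  assumes "v \<in> alive h" "y \<in> alive h" "y \<noteq> v"
  shows "card (alive (h @ [v, y])) + 2 \<le> card (alive h)"
  using card_alive_drop[OF alive_snoc2[of h v y]] assms by simp

lemma dangling_snoc2:
  "dangling (h @ [v, y]) = (dangling (h @ [v]) \<union> ({y} \<inter> uncovered (h @ [v]))) - N y"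
  using dangling_snoc[of "h @ [v]" y] by simp

text \<open>Adjacent \<open>v\<close> and \<open>y\<close> cover each other, so such a pair of moves
  creates nothing dangling.\<close>

lemma dangling_cover:
  assumes "y \<in> N v"
  shows "dangling (h @ [v, y]) = dangling h - N v - N y"
  using assms N_sym by (auto simp: dangling_snoc2 dangling_snoc uncovered_snoc)

lemma forces_reply:
  assumes "odd (length h)" "LL_legal G (h @ [v]) y" "forces G j (h @ [v, y])" "j + 2 \<le> k"
  shows "\<exists>i. forces G i (h @ [v]) \<and> Suc i \<le> k"
proof -
  have "forces G (Suc j) (h @ [v])"
    by (rule forces_dominator[of _ _ y j]) (use assms in auto)
  then show ?thesis using assms(4) by (intro exI[of _ "Suc j"]) (simp del: forces.simps)
qed

section \<open>Dominator's strategy\<close>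

text \<open>
  The credit is a move that Dominator is certain to save later, at the latest when the last vertex
  of \<open>C\<close> gets covered. With \<open>C = {}\<close> the bound below is the general one.
\<close>

definition credit :: "'a set \<Rightarrow> 'a list \<Rightarrow> nat" where
  "credit C h = (if uncovered h \<inter> C = {} then 0 else 1)"

section \<open>Upper bound with a credit from components of minimum degree at least 2\<close>

context
  fixes C :: "'a set"
  assumes C_closed: "x \<in> C \<Longrightarrow> N x \<subseteq> C"
    and C_degree: "x \<in> C \<Longrightarrow> 2 \<le> card (N x)"
begin

text \<open>An uncovered vertex of \<open>C\<close> has two neighbors, all alive. Hence subtracting
  the credit from the number of alive vertices is never truncated.\<close>

lemma credit_le: "2 * credit C h \<le> card (alive h)"
proof (cases "uncovered h \<inter> C = {}")
  case False
  then obtain x where "x \<in> uncovered h" "x \<in> C" by auto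
  then have "2 \<le> card (N x)" "card (N x) \<le> card (alive h)"
    by (auto intro!: C_degree card_mono N_alive)
  with False show ?thesis by (simp add: credit_def)
qed (simp add: credit_def)

text \<open>Since \<open>C\<close> is closed under adjacency, covering all of it kills all its alive
  vertices. These include the neighbors of a previously uncovered \<open>x\<close>, and also
  \<open>x\<close> itself if it was not dangling.\<close>

lemma credit_lost:
  assumes "credit C h' < credit C h" "alive h' \<subseteq> alive h"
  shows "card (alive h') + 2 \<le> card (alive h)"
    and "dangling h \<inter> C = {} \<Longrightarrow> card (alive h') + 3 \<le> card (alive h)"
proof -
  obtain x where x: "x \<in> uncovered h" "x \<in> C" and covered: "uncovered h' \<inter> C = {}"
    using assms(1) by (auto simp: credit_def split: if_splits)
  have dead: "C \<inter> alive h' = {}"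
    using C_closed covered by (fastforce simp: alive_def closed_nbhd_def)
  have "card (alive h') + card (N x) \<le> card (alive h)"
    by (rule card_alive_drop) (use x assms dead C_closed N_alive in blast)+
  with C_degree[OF x(2)] show "card (alive h') + 2 \<le> card (alive h)" by simp
  assume "dangling h \<inter> C = {}"
  with x have "x \<in> alive h" by (auto intro: uncovered_alive simp: dangling_def)
  have "card (alive h') + card (insert x (N x)) \<le> card (alive h)"
    by (rule card_alive_drop) (use x assms dead C_closed N_alive \<open>x \<in> alive h\<close> in blast)+
  with C_degree[OF x(2)] show "card (alive h') + 3 \<le> card (alive h)" by simp
qed

text \<open>The potential is alive plus dangling vertices minus the credit. Dominator answers each
  move of Staller so that the round, if he still has to move, lowers it by at least 2 and leaves at
  most one dangling vertex.\<close>

lemma staller_bound: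
  assumes "odd (length h)" "dangling h \<subseteq> {d}"
  shows "forces G (card (alive h) + card (dangling h) - credit C h) h"
  using assms
proof (induction "card (alive h)" arbitrary: h d rule: less_induct)
  case less
  define k where "k = card (alive h) + card (dangling h) - credit C h"
  have credit01: "credit C h' \<le> 1" for h' by (simp add: credit_def)
  have credit_mono: "credit C (h @ [v, y]) \<le> credit C h" for v y
    by (auto simp: credit_def uncovered_def)
  have credit_mono1: "credit C (h @ [v]) \<le> credit C h" for v
    by (auto simp: credit_def uncovered_def)
  have alive2: "alive (h @ [v, y]) \<subseteq> alive h" for v y
    using alive_snoc2[of h v y] by blast
  have alive1: "alive (h @ [v]) \<subseteq> alive h" for v
    using alive_snoc[of h v] by blast
  note lost1 = credit_lost[OF _ alive1] and lost2 = credit_lost[OF _ alive2]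
  have IH: "forces G (card (alive (h @ [v, y])) + card (dangling (h @ [v, y])) - credit C (h @ [v, y])) (h @ [v, y])"
    if "card (alive (h @ [v, y])) < card (alive h)" "dangling (h @ [v, y]) \<subseteq> {d'}" for v y d'
    using less.hyps[OF that(1) _ that(2)] less.prems(1) by simp
  \<comment> \<open>The required drop by 2 is stated with sums only, to avoid truncated subtraction;
    \<open>credit_le\<close> converts it.\<close>
  have reply: "\<exists>i. forces G i (h @ [v]) \<and> Suc i \<le> k"
    if "LL_legal G (h @ [v]) y" "card (alive (h @ [v, y])) < card (alive h)"
      "dangling (h @ [v, y]) \<subseteq> {d'}"
      "card (alive (h @ [v, y])) + card (dangling (h @ [v, y])) + 2 + credit C h
         \<le> card (alive h) + card (dangling h) + credit C (h @ [v, y])" for v y d'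
  proof (rule forces_reply[OF less.prems(1) that(1) IH[OF that(2,3)]])
    show "card (alive (h @ [v, y])) + card (dangling (h @ [v, y])) - credit C (h @ [v, y]) + 2 \<le> k"
      using that(4) credit_le[of "h @ [v, y]"] credit_le[of h] unfolding k_def by linarith
  qed
  have "\<exists>j. forces G j (h @ [v]) \<and> Suc j \<le> k" if v: "LL_legal G h v" for v
  proof (cases "v \<in> set h")
    case True
    \<comment> \<open>Staller repeats the dangling vertex. Covering it by \<open>y\<close> removes
      one alive and one dangling vertex; if the credit is lost, two alive vertices go.\<close>
    have vd: "v \<in> dangling h" using v True by (rule dangling_if_repeated)
    with less.prems(2) have d: "dangling h = {v}" by auto
    from vd have vu: "v \<in> uncovered h" by (simp add: dangling_def)
    then obtain y where y: "y \<in> N v" using N_nonempty uncovered_verts by blast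
    have legal: "LL_legal G (h @ [v]) y"
      by (rule legal_N[of v]) (use vu y in \<open>auto simp: uncovered_snoc\<close>)
    have d2: "dangling (h @ [v, y]) = {}"
      using d y N_sym by (auto simp: dangling_cover)
    have "y \<in> alive h" using vu y N_alive by auto
    have a: "card (alive (h @ [v, y])) + card {y} \<le> card (alive h)"
      by (rule card_alive_drop) (use alive_snoc2[of h v y] \<open>y \<in> alive h\<close> in auto)
    show ?thesis
    proof (rule reply[OF legal, of v])
      show "card (alive (h @ [v, y])) + card (dangling (h @ [v, y])) + 2 + credit C h
         \<le> card (alive h) + card (dangling h) + credit C (h @ [v, y])"
        using a d d2 lost2(1)[of v y]
          credit_mono[of v y] credit01[of h] by (cases "credit C (h @ [v, y]) < credit C h") auto
    qed (use a d2 in auto)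
  next
    case new: False
    have v_alive: "v \<in> alive h" by (rule alive_if_legal) fact+
    have a2: "card (alive (h @ [v, y])) + 2 \<le> card (alive h)" if "y \<in> alive h" "y \<noteq> v" for y
      using card_alive_snoc2 v_alive that by simp
    show ?thesis
    proof (cases "v \<in> uncovered h")
      case True
      then obtain y where y: "y \<in> N v" using N_nonempty uncovered_verts by blast
      have "y \<in> alive h" "y \<noteq> v" using True y N_alive by auto
      note a = a2[OF this]
      have legal: "LL_legal G (h @ [v]) y"
        by (rule legal_N[of v]) (use True y in \<open>auto simp: uncovered_snoc\<close>)
      have d2: "dangling (h @ [v, y]) \<subseteq> dangling h"
        using y by (auto simp: dangling_cover)
      \<comment> \<open>If the credit is lost, nothing in \<open>C\<close> stays dangling. So either
        a dangling vertex has vanished, or none was in \<open>C\<close> before and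
        \<open>credit_lost\<close> yields a third dead vertex.\<close>
      have lost: "dangling (h @ [v, y]) \<inter> C = {}" if "credit C (h @ [v, y]) < credit C h"
        using that by (auto simp: credit_def dangling_def split: if_splits)
      have d2_cases: "dangling (h @ [v, y]) = dangling h \<or> card (dangling (h @ [v, y])) < card (dangling h)"
        using d2 by (metis psubset_card_mono psubsetI finite_Int dangling_def List.finite_set)
      show ?thesis
      proof (rule reply[OF legal, of d])
        show "card (alive (h @ [v, y])) + card (dangling (h @ [v, y])) + 2 + credit C h
           \<le> card (alive h) + card (dangling h) + credit C (h @ [v, y])"
          using a d2_cases lost lost2[of v y]
            credit_mono[of v y] credit01[of h]
          by (cases "credit C (h @ [v, y]) < credit C h") auto
      qed (use a d2 less.prems(2) in auto)
    next
      case False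
      have d1: "dangling (h @ [v]) = dangling h - N v" using False by (auto simp: dangling_snoc)
      show ?thesis
      proof (cases "dangling (h @ [v]) = {}")
        \<comment> \<open>Covering \<open>d\<close> lowers the potential by two alive vertices and
          one dangling vertex, enough even if the credit is lost.\<close>
        case nonempty: False
        then have d: "dangling h = {d}" "d \<in> dangling (h @ [v])" using d1 less.prems(2) by auto
        then have du: "d \<in> uncovered (h @ [v])" "d \<in> uncovered h" "d \<notin> N v" "d \<in> set h"
          by (auto simp: dangling_def uncovered_snoc)
        obtain y where y: "y \<in> N d" using N_nonempty uncovered_verts du by blast
        have "y \<in> alive h" "y \<noteq> v" using y du N_alive N_sym by blast+
        note a = a2[OF this]
        have d2: "dangling (h @ [v, y]) = {}"
          using d d1 y N_sym du by (auto simp: dangling_snoc2 uncovered_def)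
        show ?thesis
        proof (rule reply[OF legal_N[OF du(1) y], of d])
          show "card (alive (h @ [v, y])) + card (dangling (h @ [v, y])) + 2 + credit C h
             \<le> card (alive h) + card (dangling h) + credit C (h @ [v, y])"
            using a d d2 credit01[of h] by simp
        qed (use a d2 in auto)
      next
        case d1e: True
        show ?thesis
        proof (cases "\<exists>x\<in>uncovered (h @ [v]). \<not> N x \<subseteq> uncovered (h @ [v])")
          case True
          \<comment> \<open>Being covered, \<open>w\<close> does not become dangling when played. A
            lost credit is paid for by a third dead vertex or by a dangling vertex that Staller has
            just covered.\<close>
          then obtain x w where x: "x \<in> uncovered (h @ [v])" "w \<in> N x" "w \<notin> uncovered (h @ [v])" by blast
          then have xu: "x \<in> uncovered h" "x \<notin> N v" by (auto simp: uncovered_snoc)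
          have "w \<in> alive h" "w \<noteq> v" using x xu N_alive N_sym by blast+
          note a = a2[OF this]
          have d2: "dangling (h @ [v, w]) = {}"
            using d1e x by (auto simp: dangling_snoc2)
          show ?thesis
          proof (rule reply[OF legal_N[OF x(1,2)], of d])
            have "3 + card (alive (h @ [v, w])) \<le> card (alive h) + card (dangling h)"
              if "credit C (h @ [v, w]) < credit C h"
            proof (cases "dangling h = {}")
              case True
              with lost2(2)[OF that] show ?thesis by simp
            next
              case False
              then have "card (dangling h) \<noteq> 0" by (simp add: dangling_def)
              with a show ?thesis by simp
            qed
            with a d2 credit_mono[of v w] credit01[of h]
            show "card (alive (h @ [v, w])) + card (dangling (h @ [v, w])) + 2 + credit C h
               \<le> card (alive h) + card (dangling h) + credit C (h @ [v, w])"
              by (cases "credit C (h @ [v, w]) < credit C h") auto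
          qed (use a d2 in auto)
        next
          case closed: False
          \<comment> \<open>No edge now joins covered and uncovered vertices, and Staller's move
            alone has paid for the round: besides \<open>v\<close> it removes the dangling vertex,
            or an \<open>x\<close> covered just now whose neighbors are all covered.\<close>
          have a1: "card (alive (h @ [v])) + 2 + credit C h
              \<le> card (alive h) + card (dangling h) + credit C (h @ [v])"
          proof (cases "dangling h = {}")
            case True
            obtain x where x: "x \<in> N v" "x \<in> uncovered h"
              using v False by (auto simp: LL_legal_iff closed_nbhd_def)
            have "x \<notin> alive (h @ [v])"
              using closed x N_sym by (fastforce simp: alive_def closed_nbhd_def uncovered_snoc)
            moreover have "x \<in> alive h"
              using True x by (auto intro: uncovered_alive simp: dangling_def)
            ultimately have "card (alive (h @ [v])) + card {v, x} \<le> card (alive h)"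
              using alive_snoc v_alive by (intro card_alive_drop) auto
            moreover have "v \<noteq> x" using x by auto
            ultimately show ?thesis
              using True lost1(2)[of v]
                credit_mono1[of v] credit01[of h]
              by (cases "credit C (h @ [v]) < credit C h") auto
          next
            case False
            then have "card (dangling h) \<noteq> 0" by (simp add: dangling_def)
            moreover have "card (alive (h @ [v])) + card {v} \<le> card (alive h)"
              using alive_snoc v_alive by (intro card_alive_drop) auto
            ultimately show ?thesis
              using lost1(1)[of v]
                credit_mono1[of v] credit01[of h]
              by (cases "credit C (h @ [v]) < credit C h") auto
          qed
          show ?thesis
          proof (cases "uncovered (h @ [v]) = {}")
            case True
            have "0 < k"
              using a1 credit_le[of "h @ [v]"] credit01[of h] credit01[of "h @ [v]"] unfolding k_def by linarith
            moreover have "forces G 0 (h @ [v])" using True by (intro forces_over) (simp add: LL_over_iff)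
            ultimately show ?thesis by (intro exI[of _ 0]) (simp del: forces.simps)
          next
            case False
            \<comment> \<open>Opening with \<open>y\<close> is neutral, one alive vertex less and
              one dangling vertex more. It is taken from \<open>C\<close> if possible, since
              \<open>y\<close> stays uncovered and so preserves the credit.\<close>
            then obtain y where y: "y \<in> uncovered (h @ [v])"
              "uncovered (h @ [v]) \<inter> C \<noteq> {} \<Longrightarrow> y \<in> C" by blast
            then have "y \<notin> set (h @ [v])" using d1e by (auto simp: dangling_def)
            with y have "y \<in> alive (h @ [v])" by (intro uncovered_alive)
            then have a: "card (alive (h @ [v, y])) + card {y} \<le> card (alive (h @ [v]))"
              using alive_snoc[of "h @ [v]" y] by (intro card_alive_drop) auto
            have d2: "dangling (h @ [v, y]) = {y}"
              using d1e y by (auto simp: dangling_snoc2)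
            have legal: "LL_legal G (h @ [v]) y"
              using y uncovered_verts by (auto simp: LL_legal_iff closed_nbhd_def)
            have c2: "credit C (h @ [v]) \<le> credit C (h @ [v, y])"
            proof (cases "uncovered (h @ [v]) \<inter> C = {}")
              case False
              with y have "y \<in> uncovered (h @ [v, y]) \<inter> C"
                using uncovered_snoc[of "h @ [v]" y] by simp
              then show ?thesis by (auto simp: credit_def)
            qed (simp add: credit_def)
            have "card (alive (h @ [v])) \<le> card (alive h)"
              using alive_snoc by (intro card_mono) auto
            show ?thesis
              by (rule reply[OF legal, of y]) (use a a1 c2 d2 \<open>card (alive (h @ [v])) \<le> card (alive h)\<close> in auto)
          qed
        qed
      qed
    qed
  qed
  then show ?case unfolding k_def[symmetric] by (rule forces_staller[OF less.prems(1)])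
qed

end

lemma staller_bound_uncredited:
  assumes "odd (length h)" "dangling h \<subseteq> {d}"
  shows "forces G (card (alive h) + card (dangling h)) h"
  using staller_bound[of "{}" h d] assms by (simp add: credit_def)

text \<open>This saves one move over the general bound. While \<open>d\<close> dangles, every round
  costs two alive vertices; once \<open>d\<close> is covered and nothing dangles, the general bound
  has no extra term.\<close>

lemma leaf_bound:
  assumes l: "N l = {d}" and deg: "2 \<le> card (N d)"
    and "odd (length h)" "dangling h = {d}"
  shows "forces G (card (alive h)) h"
  using assms(3,4)
proof (induction "card (alive h)" arbitrary: h rule: less_induct)
  case less
  have du: "d \<in> uncovered h" "d \<in> set h" using less.prems by (auto simp: dangling_def)
  have nbr: "\<exists>w\<in>N d. w \<noteq> x" for x
  proof (rule ccontr)
    assume "\<not> ?thesis"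
    then have "card (N d) \<le> card {x}" by (intro card_mono) auto
    with deg show False by simp
  qed
  have reply: "\<exists>i. forces G i (h @ [v]) \<and> Suc i \<le> card (alive h)"
    if "LL_legal G (h @ [v]) y" "card (alive (h @ [v, y])) + 2 \<le> card (alive h)"
      "dangling (h @ [v, y]) = {} \<or> dangling (h @ [v, y]) = {d}" for v y
  proof (rule forces_reply[OF less.prems(1) that(1) _ that(2)])
    show "forces G (card (alive (h @ [v, y]))) (h @ [v, y])"
      using that(3)
    proof
      assume "dangling (h @ [v, y]) = {}"
      then show ?thesis using staller_bound_uncredited[of "h @ [v, y]" d] less.prems(1) by simp
    next
      assume "dangling (h @ [v, y]) = {d}"
      then show ?thesis using less.hyps[of "h @ [v, y]"] less.prems(1) that(2) by simp
    qed
  qed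
  have "\<exists>j. forces G j (h @ [v]) \<and> Suc j \<le> card (alive h)" if v: "LL_legal G h v" for v
  proof (cases "v \<in> set h")
    case True
    then have v_eq: "v = d" using dangling_if_repeated[OF v] less.prems by auto
    obtain y where y: "y \<in> N d" "y \<noteq> l" using nbr by blast
    have "l \<in> N d" "d \<in> N y" using l y N_sym by auto
    \<comment> \<open>The leaf is covered by \<open>d\<close>, and its only neighbor
      \<open>d\<close> by \<open>y\<close>, so \<open>l\<close> dies unselected.\<close>
    then have "l \<notin> alive (h @ [d, y])"
      using l by (auto simp: alive_def closed_nbhd_def uncovered_def)
    moreover have "l \<in> alive h" "y \<in> alive h" using \<open>l \<in> N d\<close> y du N_alive by blast+
    ultimately have "card (alive (h @ [d, y])) + card {y, l} \<le> card (alive h)"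
      using alive_snoc2[of h d y] by (intro card_alive_drop) auto
    with y have a: "card (alive (h @ [d, y])) + 2 \<le> card (alive h)" by simp
    show ?thesis unfolding v_eq
    proof (rule reply[OF legal_N[of d] a])
      show "d \<in> uncovered (h @ [d])" using du by (simp add: uncovered_snoc)
      show "dangling (h @ [d, y]) = {} \<or> dangling (h @ [d, y]) = {d}"
        using y less.prems by (auto simp: dangling_cover)
    qed (rule y)
  next
    case False
    with v have v_alive: "v \<in> alive h" by (rule alive_if_legal)
    note a2 = card_alive_snoc2[OF v_alive]
    show ?thesis
    proof (cases "v \<in> uncovered h")
      case True
      then obtain y where y: "y \<in> N v" using N_nonempty uncovered_verts by blast
      have "y \<in> alive h" "y \<noteq> v" using True y N_alive by auto
      note a = a2[OF this]
      show ?thesis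
      proof (rule reply[OF legal_N[of v] a])
        show "v \<in> uncovered (h @ [v])" using True by (simp add: uncovered_snoc)
        show "dangling (h @ [v, y]) = {} \<or> dangling (h @ [v, y]) = {d}"
          using y less.prems by (auto simp: dangling_cover)
      qed (rule y)
    next
      case False
      then have d1: "dangling (h @ [v]) = {d} - N v"
        using less.prems by (auto simp: dangling_snoc)
      show ?thesis
      proof (cases "d \<in> N v")
        case dv: False
        obtain y where y: "y \<in> N d" using nbr by blast
        have "y \<in> alive h" using y du N_alive by blast
        moreover have "y \<noteq> v" using y dv N_sym by blast
        ultimately have a: "card (alive (h @ [v, y])) + 2 \<le> card (alive h)" by (rule a2)
        show ?thesis
        proof (rule reply[OF legal_N[of d] a])
          show "d \<in> uncovered (h @ [v])" using du dv by (simp add: uncovered_snoc)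
          show "dangling (h @ [v, y]) = {} \<or> dangling (h @ [v, y]) = {d}"
            using d1 y du by (auto simp: dangling_snoc2 uncovered_def)
        qed (rule y)
      next
        case dv: True
        with d1 have d1e: "dangling (h @ [v]) = {}" by simp
        show ?thesis
        proof (cases "\<exists>x\<in>uncovered (h @ [v]). \<not> N x \<subseteq> uncovered (h @ [v])")
          case True
          then obtain x w where x: "x \<in> uncovered (h @ [v])" "w \<in> N x" "w \<notin> uncovered (h @ [v])"
            by blast
          then have xu: "x \<in> uncovered h" "x \<notin> N v" by (auto simp: uncovered_snoc)
          have "w \<in> alive h" "w \<noteq> v" using x xu N_alive N_sym by blast+
          note a = a2[OF this]
          show ?thesis
            by (rule reply[OF legal_N[OF x(1,2)] a]) (use d1e x in \<open>auto simp: dangling_snoc2\<close>)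
        next
          case closed: False
          \<comment> \<open>Staller has covered \<open>d\<close> by \<open>v\<close>. Another
            neighbor \<open>w\<close> of \<open>d\<close> is covered by \<open>d\<close> and has no
            uncovered neighbor left, so it dies along with \<open>v\<close>; this pays for opening a
            new part.\<close>
          obtain w where w: "w \<in> N d" "w \<noteq> v" using nbr by blast
          have "w \<notin> alive (h @ [v])"
          proof -
            have "w \<notin> uncovered (h @ [v])" using w du by (auto simp: uncovered_def)
            moreover from this have "z \<notin> uncovered (h @ [v])" if "z \<in> N w" for z
              using that closed N_sym by blast
            ultimately show ?thesis by (auto simp: alive_def closed_nbhd_def)
          qed
          moreover have "w \<in> alive h" using w du N_alive by blast
          ultimately have "card (alive (h @ [v])) + card {v, w} \<le> card (alive h)"
            using alive_snoc v_alive by (intro card_alive_drop) auto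
          with w have a1: "card (alive (h @ [v])) + 2 \<le> card (alive h)" by simp
          show ?thesis
          proof (cases "uncovered (h @ [v]) = {}")
            case True
            then have "forces G 0 (h @ [v])" by (intro forces_over) (simp add: LL_over_iff)
            with a1 show ?thesis by (intro exI[of _ 0]) (simp del: forces.simps)
          next
            case False
            then obtain y where y: "y \<in> uncovered (h @ [v])" by blast
            then have "y \<notin> set (h @ [v])" using d1e by (auto simp: dangling_def)
            with y have "y \<in> alive (h @ [v])" by (intro uncovered_alive)
            then have a: "card (alive (h @ [v, y])) + card {y} \<le> card (alive (h @ [v]))"
              using alive_snoc[of "h @ [v]" y] by (intro card_alive_drop) auto
            have d2: "dangling (h @ [v, y]) = {y}"
              using d1e y by (auto simp: dangling_snoc2)
            have legal: "LL_legal G (h @ [v]) y"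
              using y uncovered_verts by (auto simp: LL_legal_iff closed_nbhd_def)
            show ?thesis
              by (rule forces_reply[OF less.prems(1) legal staller_bound_uncredited[of _ y]])
                (use a a1 d2 less.prems(1) in auto)
          qed
        qed
      qed
    qed
  qed
  then show ?case by (rule forces_staller[OF less.prems(1)])
qed

section \<open>The opening move and the two upper bounds\<close>

lemma uncovered_Nil [simp]: "uncovered [] = verts G"
  by (simp add: uncovered_def)

lemma first_move:
  assumes "d \<in> verts G"
  shows "LL_legal G [] d" "dangling [d] = {d}" "uncovered [d] = verts G - N d"
    "Suc (card (alive [d])) \<le> card (verts G)"
proof -
  show "LL_legal G [] d" "dangling [d] = {d}" "uncovered [d] = verts G - N d"
    using assms by (auto simp: LL_legal_iff closed_nbhd_def dangling_def uncovered_def)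
  have "card (alive [d]) \<le> card (verts G - {d})"
    by (rule card_mono) (auto simp: alive_def)
  also have "\<dots> < card (verts G)" using assms by (intro card_Diff1_less) auto
  finally show "Suc (card (alive [d])) \<le> card (verts G)" by simp
qed

text \<open>After any opening at most n - 1 vertices are alive and one dangles, which with the
  opening itself makes n + 1 moves.\<close>

lemma gamma_LLg_le: "gamma_LLg G \<le> enat (card (verts G) + 1)"
proof (rule gamma_LLg_le_if_forces)
  show "forces G (card (verts G) + 1) []"
  proof (cases "verts G = {}")
    case True
    then show ?thesis by (intro forces_over) (simp add: LL_over_iff)
  next
    case False
    then obtain d where d: "d \<in> verts G" by blast
    show ?thesis
      by (rule forces_dominator[OF _ first_move(1)[OF d] staller_bound_uncredited[of _ d, simplified]])
        (use first_move[OF d] in auto)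
  qed
qed

text \<open>Either some leaf hangs on a vertex of degree at least 2, which is the opening for
  \<open>leaf_bound\<close>, or the vertices of degree at least 2 are closed under adjacency and
  provide the credit.\<close>

lemma gamma_LLg_le_card:
  assumes deg: "2 \<le> card (N v)"
  shows "gamma_LLg G \<le> enat (card (verts G))"
proof (rule gamma_LLg_le_if_forces)
  have in_verts: "d \<in> verts G" if "2 \<le> card (N d)" for d
    using that N_verts(2)[of _ d] by (cases "N d = {}") auto
  show "forces G (card (verts G)) []"
  proof (cases "\<exists>l d. N l = {d} \<and> 2 \<le> card (N d)")
    case True
    then obtain l d where l: "N l = {d}" "2 \<le> card (N d)" by blast
    note d = in_verts[OF l(2)]
    show ?thesis
      by (rule forces_dominator[OF _ first_move(1)[OF d] leaf_bound[OF l]]) (use first_move[OF d] in auto)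
  next
    case False
    define C where "C = {x. 2 \<le> card (N x)}"
    have closed: "N x \<subseteq> C" if x: "x \<in> C" for x
    proof
      fix w assume "w \<in> N x"
      then have "x \<in> N w" using N_sym by blast
      then have "0 < card (N w)" by (auto simp: card_gt_0_iff)
      moreover have "card (N w) \<noteq> 1"
        using False x \<open>x \<in> N w\<close> by (auto simp: C_def card_1_singleton_iff)
      ultimately show "w \<in> C" unfolding C_def mem_Collect_eq by linarith
    qed
    note v = in_verts[OF deg]
    \<comment> \<open>The opening vertex is itself an uncovered member of \<open>C\<close>, so the
      credit cancels its dangling term.\<close>
    have "credit C [v] = 1" using first_move(3)[OF v] deg v by (auto simp: credit_def C_def)
    moreover have "forces G (card (alive [v]) + card (dangling [v]) - credit C [v]) [v]"
    proof (rule staller_bound[of C _ v])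
      show "2 \<le> card (N x)" if "x \<in> C" for x using that by (simp add: C_def)
    qed (use closed first_move(2)[OF v] in simp_all)
    ultimately have "forces G (card (alive [v])) [v]"
      unfolding first_move(2)[OF v] by simp
    then show ?thesis
      by (intro forces_dominator[OF _ first_move(1)[OF v] _ first_move(4)[OF v]]) simp_all
  qed
qed

section \<open>Staller's strategy on a perfect matching\<close>

text \<open>Every move covers at most one new vertex, and Staller's repetition of the first move
  covers none.\<close>

lemma le_gamma_LLg:
  assumes nonempty: "verts G \<noteq> {}" and deg: "\<And>v. v \<in> verts G \<Longrightarrow> card (N v) = 1"
  shows "enat (card (verts G) + 1) \<le> gamma_LLg G"
proof -
  \<comment> \<open>The repetition is legal because the first selected vertex is still
    uncovered.\<close>
  have "\<exists>\<tau>\<in>LL_strategies G. \<forall>h. \<not> LL_over G h \<longrightarrow>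
      (\<exists>v\<in>verts G. h = [v]) \<longrightarrow> \<tau> h = hd h"
    by (rule strategy_ex) (auto simp: LL_legal_iff closed_nbhd_def uncovered_def)
  then obtain \<tau> where \<tau>: "\<tau> \<in> LL_strategies G"
    and repeat: "\<And>v. v \<in> verts G \<Longrightarrow> \<not> LL_over G [v] \<Longrightarrow> \<tau> [v] = v"
    by auto
  have "enat (card (verts G) + 1) \<le> LL_length G \<sigma> \<tau>" if \<sigma>: "\<sigma> \<in> LL_strategies G" for \<sigma>
  proof -
    define p where "p = LL_play G \<sigma> \<tau>"
    \<comment> \<open>The first two alternatives are the histories before the wasted move, where the
      sum is still only n.\<close>
    define bal where "bal h \<longleftrightarrow> h = [] \<or> (\<exists>v\<in>verts G. h = [v]) \<or>
      card (verts G) + 1 \<le> card (uncovered h) + length h" for h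
    have card_snoc: "card (uncovered h) \<le> card (uncovered (h @ [v])) + 1" if "v \<in> verts G" for h v
      using diff_card_le_card_Diff[of "N v" "uncovered h"] deg[OF that] by (simp add: uncovered_snoc)
    have inv: "bal (p m) \<and> (LL_over G (p m) \<or> length (p m) = m)" for m
    proof (induction m)
      case 0
      then show ?case by (simp add: p_def bal_def)
    next
      case (Suc m)
      show ?case
      proof (cases "LL_over G (p m)")
        case True
        with Suc show ?thesis by (simp add: p_def)
      next
        case False
        define v where "v = (if even (length (p m)) then \<sigma> (p m) else \<tau> (p m))"
        have step: "p (Suc m) = p m @ [v]" using False by (simp add: p_def v_def Let_def)
        have "LL_legal G (p m) v" using False \<sigma> \<tau> by (auto simp: LL_strategies_def v_def)
        then have v: "v \<in> verts G" by (simp add: LL_legal_iff)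
        have "bal (p m @ [v])"
        proof -
          consider "p m = []" | u where "u \<in> verts G" "p m = [u]"
            | "card (verts G) + 1 \<le> card (uncovered (p m)) + length (p m)"
            using Suc by (auto simp: bal_def)
          then show ?thesis
          proof cases
            case 2
            then have "v = u" using repeat False by (simp add: v_def)
            with 2 have "uncovered (p m @ [v]) = uncovered [u]" by (auto simp: uncovered_def)
            with 2 card_snoc[of u "[]"] show ?thesis by (simp add: bal_def)
          qed (use v card_snoc[of v "p m"] in \<open>auto simp: bal_def\<close>)
        qed
        with Suc False step show ?thesis by simp
      qed
    qed
    \<comment> \<open>If the game has ended, the uncovered set is empty and the invariant bounds the
      length; otherwise every round has added a move.\<close>
    have "card (verts G) + 1 \<le> length (p (card (verts G) + 1))"
    proof (cases "LL_over G (p (card (verts G) + 1))")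
      case True
      then have over: "uncovered (p (card (verts G) + 1)) = {}" by (simp add: LL_over_iff)
      have "uncovered [v] \<noteq> {}" if "v \<in> verts G" for v
        using first_move(3)[OF that] that by auto
      with over nonempty
      have "p (card (verts G) + 1) \<noteq> []" "\<not> (\<exists>v\<in>verts G. p (card (verts G) + 1) = [v])"
        by force+
      with inv[of "card (verts G) + 1"] over show ?thesis unfolding bal_def by simp
    next
      case False
      with inv[of "card (verts G) + 1"] show ?thesis by linarith
    qed
    then have "enat (card (verts G) + 1) \<le> enat (length (p (card (verts G) + 1)))" by simp
    also have "\<dots> \<le> LL_length G \<sigma> \<tau>" unfolding LL_length_def p_def by (rule SUP_upper) simp
    finally show ?thesis .
  qed
  with \<tau> show ?thesis unfolding gamma_LLg_def by (meson INF_greatest SUP_upper2)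
qed

section \<open>Components isomorphic to the complete graph on two vertices\<close>

text \<open>Connectedness of \<open>H\<close> refers to the symmetric closure of its arcs, and
  \<open>G\<close> contains that closure because it is symmetric.\<close>

lemma connected_subgraph_reachable:
  assumes "subgraph H G" "Digraph_Component.connected H" "v \<in> verts H" "w \<in> verts H"
  shows "v \<rightarrow>\<^sup>* w"
proof -
  have "arcs_ends H \<subseteq> arcs_ends G"
    using assms(1) by (auto simp: arcs_ends_conv subgraph_def compatible_def)
  then have "symcl (arcs_ends H) \<subseteq> arcs_ends G"
    using graph_symmetric by (auto simp: symcl_def)
  moreover have "verts H \<subseteq> verts G" using assms(1) by (rule subgraph_imp_subverts)
  moreover have "(v, w) \<in> rtrancl_on (verts H) (symcl (arcs_ends H))"
    using assms by (simp add: connected_conv)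
  ultimately show ?thesis unfolding reachable_def by (rule rtrancl_on_mono)
qed

lemma connected_reachable_set:
  assumes "v \<in> verts G"
  shows "Digraph_Component.connected (G \<restriction> {w. v \<rightarrow>\<^sup>* w})"
proof -
  have sccs: "G \<restriction> {w. v \<rightarrow>\<^sup>* w} \<in> sccs" by (rule induce_reachable_is_in_sccs) fact
  then interpret H: wf_digraph "G \<restriction> {w. v \<rightarrow>\<^sup>* w}"
    by (rule wf_digraphI_induced[OF in_sccs_imp_induced])
  from sccs have "strongly_connected (G \<restriction> {w. v \<rightarrow>\<^sup>* w})" by (rule in_sccsE)
  then show ?thesis
    unfolding Digraph_Component.connected_def strongly_connected_def
    using H.reachable_mk_symmetricI by auto
qed

lemma subgraph_reachable_set: "subgraph (G \<restriction> {w. v \<rightarrow>\<^sup>* w}) G"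
  by (intro subgraph_induce_subgraphI) (auto elim: reachable_in_vertsE)

lemma subgraph_of_reachable_set:
  assumes "subgraph H G" "Digraph_Component.connected H" "v \<in> verts H"
  shows "subgraph H (G \<restriction> {w. v \<rightarrow>\<^sup>* w})"
proof -
  have "verts H \<subseteq> {w. v \<rightarrow>\<^sup>* w}"
    using connected_subgraph_reachable[OF assms] by auto
  moreover have "tail G e \<in> verts H \<and> head G e \<in> verts H" if "e \<in> arcs H" for e
    using assms(1) that by (auto simp: subgraph_def compatible_def dest: wf_digraph.wellformed)
  ultimately show ?thesis
    using assms(1) subgraph_reachable_set[of v] by (auto simp: subgraph_def compatible_def)
qed

text \<open>The subgraph induced on the vertices reachable from \<open>v\<close> is connected and
  contains every connected subgraph through \<open>v\<close>, so it is the maximal one.\<close>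

lemma component_iff: "component G C \<longleftrightarrow> (\<exists>v\<in>verts G. C = G \<restriction> {w. v \<rightarrow>\<^sup>* w})"
proof
  assume "component G C"
  then have C: "subgraph C G" "Digraph_Component.connected C"
    and max: "\<And>H. subgraph C H \<Longrightarrow> subgraph H G \<Longrightarrow> Digraph_Component.connected H \<Longrightarrow> H = C"
    unfolding component_def max_subgraph_def by auto
  then obtain v where "v \<in> verts C" by (auto simp: connected_conv)
  moreover from this C(1) have "v \<in> verts G" by (auto simp: subgraph_def)
  ultimately show "\<exists>v\<in>verts G. C = G \<restriction> {w. v \<rightarrow>\<^sup>* w}"
    using max[OF subgraph_of_reachable_set[OF C] subgraph_reachable_set connected_reachable_set]
    by blast
next
  assume "\<exists>v\<in>verts G. C = G \<restriction> {w. v \<rightarrow>\<^sup>* w}"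
  then obtain v where v: "v \<in> verts G" and C: "C = G \<restriction> {w. v \<rightarrow>\<^sup>* w}" by blast
  show "component G C" unfolding component_def
  proof (rule max_subgraphI)
    show "Digraph_Component.connected C" unfolding C by (rule connected_reachable_set) fact
    show "subgraph C G" unfolding C by (rule subgraph_reachable_set)
    fix H assume "C \<noteq> H" "subgraph C H" "subgraph H G"
    show "\<not> Digraph_Component.connected H"
    proof
      assume "Digraph_Component.connected H"
      moreover have "v \<in> verts H"
        using \<open>subgraph C H\<close> v by (auto simp: C subgraph_def)
      ultimately have "subgraph H C"
        unfolding C using \<open>subgraph H G\<close> by (intro subgraph_of_reachable_set)
      with \<open>subgraph C H\<close> have "C = H"
        by (intro pre_digraph.equality) (auto simp: subgraph_def compatible_def)
      with \<open>C \<noteq> H\<close> show False ..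
    qed
  qed
qed

text \<open>The isomorphism sends \<open>v\<close> to 0, \<open>u\<close> to 1 and an arc to the
  pair of images of its ends; it is injective on arcs because there are no parallel ones.\<close>

lemma induce_edge_iso:
  assumes u: "u \<in> N v"
  shows "digraph_iso (G \<restriction> {v, u}) (with_proj (complete_graph 2))"
proof -
  let ?H = "G \<restriction> {v, u}"
  define f :: "'a \<Rightarrow> nat" where "f x = (if x = v then 0 else 1)" for x
  define \<phi> where "\<phi> = \<lparr> iso_verts = f, iso_arcs = (\<lambda>e. (f (tail G e), f (head G e))),
    iso_head = snd, iso_tail = fst \<rparr>"
  have uv: "u \<noteq> v" "v \<in> N u" using u N_sym by auto
  have sub: "subgraph ?H G"
    using u by (intro subgraph_induce_subgraphI) (auto dest: N_verts)
  then interpret H: wf_digraph ?H by (simp add: subgraph_def)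
  have f_inj: "inj_on f {v, u}" using uv by (auto simp: f_def)
  have "inj_on (\<lambda>e. (f (tail G e), f (head G e))) (arcs ?H)"
  proof (rule inj_onI)
    fix a b assume "a \<in> arcs ?H" "b \<in> arcs ?H"
      and "(f (tail G a), f (head G a)) = (f (tail G b), f (head G b))"
    then have "a \<in> arcs G" "b \<in> arcs G" "tail G a = tail G b" "head G a = head G b"
      using inj_onD[OF f_inj] by auto
    then show "a = b" by (intro no_multi_arcs) (auto simp: arc_to_ends_def)
  qed
  then have iso: "pre_digraph.digraph_isomorphism ?H \<phi>"
    using f_inj H.wf_digraph by (simp add: pre_digraph.digraph_isomorphism_def \<phi>_def)
  have "(\<lambda>e. (f (tail G e), f (head G e))) ` arcs ?H = {(0, 1), (1, 0)}" (is "?L = ?R")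
  proof
    show "?L \<subseteq> ?R"
    proof (rule image_subsetI)
      fix e assume "e \<in> arcs ?H"
      then have "e \<in> arcs G" "tail G e \<in> {v, u}" "head G e \<in> {v, u}" by auto
      with no_loops[of e] uv(1) show "(f (tail G e), f (head G e)) \<in> ?R" by (auto simp: f_def)
    qed
    obtain a b where "a \<in> arcs ?H" "tail G a = v" "head G a = u"
      and "b \<in> arcs ?H" "tail G b = u" "head G b = v"
      using u uv by (auto simp: open_nbhd_def arcs_ends_conv)
    then have "(f v, f u) \<in> ?L" "(f u, f v) \<in> ?L" by (metis (no_types, lifting) imageI)+
    with uv(1) show "?R \<subseteq> ?L" by (simp add: f_def)
  qed
  moreover have "{(i, j). i < 2 \<and> j < 2 \<and> i \<noteq> j} = {(0, 1), (1, 0 :: nat)}" by auto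
  moreover have "f ` {v, u} = {..<2}" using uv by (auto simp: f_def lessThan_nat_numeral)
  ultimately have "with_proj (complete_graph 2) = app_iso \<phi> ?H"
    by (intro pre_digraph.equality) (simp_all add: \<phi>_def complete_graph_def)
  with iso show ?thesis unfolding digraph_iso_def by blast
qed

text \<open>A reachable set of size 2 leaves room for only one neighbor of \<open>v\<close>.
  Conversely, if all degrees are 1, \<open>v\<close> and its neighbor see only each other, so
  nothing else is reachable.\<close>

lemma components_K2_iff:
  "(\<forall>C. component G C \<longrightarrow> digraph_iso C (with_proj (complete_graph 2))) \<longleftrightarrow>
    (\<forall>v\<in>verts G. card (N v) = 1)"
proof
  assume K2: "\<forall>C. component G C \<longrightarrow> digraph_iso C (with_proj (complete_graph 2))"
  show "\<forall>v\<in>verts G. card (N v) = 1"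
  proof
    fix v assume v: "v \<in> verts G"
    let ?R = "{w. v \<rightarrow>\<^sup>* w}"
    have "digraph_iso (G \<restriction> ?R) (with_proj (complete_graph 2))"
      using K2 v component_iff by blast
    then obtain \<phi> where iso: "pre_digraph.digraph_isomorphism (G \<restriction> ?R) \<phi>"
      and "with_proj (complete_graph 2) = app_iso \<phi> (G \<restriction> ?R)"
      unfolding digraph_iso_def by blast
    then have "verts (with_proj (complete_graph 2)) = iso_verts \<phi> ` ?R" by simp
    then have "iso_verts \<phi> ` ?R = {..<2}" by (simp add: complete_graph_def)
    then have "card (iso_verts \<phi> ` ?R) = 2" by (metis card_lessThan)
    moreover have "inj_on (iso_verts \<phi>) ?R"
      using iso by (simp add: pre_digraph.digraph_isomorphism_def)
    ultimately have card: "card ?R = 2" by (simp add: card_image)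
    have "N v \<subseteq> ?R - {v}" by (auto simp: open_nbhd_def dest: adj_not_same)
    moreover have "finite ?R" using card by (intro card_ge_0_finite) simp
    ultimately have "card (N v) \<le> card (?R - {v})" by (intro card_mono) auto
    also have "\<dots> = 1" using card v by simp
    finally have "card (N v) \<le> 1" .
    moreover have "card (N v) \<noteq> 0" using N_nonempty[OF v] by simp
    ultimately show "card (N v) = 1" by linarith
  qed
next
  assume deg: "\<forall>v\<in>verts G. card (N v) = 1"
  show "\<forall>C. component G C \<longrightarrow> digraph_iso C (with_proj (complete_graph 2))"
  proof (intro allI impI)
    fix C assume "component G C"
    then obtain v where v: "v \<in> verts G" and C: "C = G \<restriction> {w. v \<rightarrow>\<^sup>* w}"
      using component_iff by blast
    from deg v obtain u where u: "N v = {u}" by (metis card_1_singletonE)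
    then have "u \<in> verts G" "v \<in> N u" using N_verts N_sym by blast+
    with deg have "N u = {v}" by (metis card_1_singletonE singletonD)
    have "w \<in> {v, u}" if "v \<rightarrow>\<^sup>* w" for w
      using that
    proof (induction rule: reachable_induct)
      case (step x y)
      then have "y \<in> N x" by (simp add: open_nbhd_def)
      with step u \<open>N u = {v}\<close> show ?case by auto
    qed simp
    moreover have "v \<rightarrow>\<^sup>* u" using u by (auto simp: open_nbhd_def)
    ultimately have "{w. v \<rightarrow>\<^sup>* w} = {v, u}" using v by auto
    with u show "digraph_iso C (with_proj (complete_graph 2))"
      unfolding C by (simp add: induce_edge_iso)
  qed
qed

end

theorem theorem4p4:
  fixes G :: "('a, 'b) pre_digraph"
  assumes "graph G" and "verts G \<noteq> {}"
    and "\<not> (\<exists>v. isolated G v)"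
  shows "gamma_LLg G \<le> enat (card (verts G) + 1) \<and>
    (gamma_LLg G = enat (card (verts G) + 1) \<longleftrightarrow>
      (\<forall>C. component G C \<longrightarrow> digraph_iso C (with_proj (complete_graph 2))))"
proof -
  interpret LL_graph G
    using assms by (simp add: LL_graph_def LL_graph_axioms_def)
  have "gamma_LLg G = enat (card (verts G) + 1) \<longleftrightarrow> (\<forall>v\<in>verts G. card (N v) = 1)"
  proof
    assume eq: "gamma_LLg G = enat (card (verts G) + 1)"
    show "\<forall>v\<in>verts G. card (N v) = 1"
    proof
      fix v assume "v \<in> verts G"
      then have "card (N v) \<noteq> 0" using N_nonempty by simp
      moreover have "\<not> 2 \<le> card (N v)" using gamma_LLg_le_card[of v] eq by auto
      ultimately show "card (N v) = 1" by linarith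
    qed
  next
    assume "\<forall>v\<in>verts G. card (N v) = 1"
    then show "gamma_LLg G = enat (card (verts G) + 1)"
      using assms(2) gamma_LLg_le le_gamma_LLg by (intro antisym) auto
  qed
  with gamma_LLg_le components_K2_iff show ?thesis by simp
qed

end
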